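(* Let $D$ be a bounded open convex set in $\mathbb{R}^d$, containing the origin, with a $C^1$ boundary (i.e., at each boundary point there is a unique tangent plane). Let $c_n>0$ decrease to zero such that $c_{n+1}/c_n\to 0$, and let $r_n$ be positive reals such that $r_{n+1}/r_n\to 1$. If $\mathbf X$ is a random vector in $\mathbb{R}^d$ with a continuous probability density $f$ whose level sets satisfy, for some $n_0$, $$\{f>c_n\}=r_nD\qquad \text{for all } n\ge n_0,$$ then the components of $\mathbf X$ are asymptotically independent.
   Context: Level sets: $\{f>c\}=\{\mathbf x\in\mathbb{R}^d: f(\mathbf x)>c\}$. A tangent plane to the convex open set $D$ at a boundary point $\mathbf p$ is a hyperplane containing $\mathbf p$ and not intersecting $D$. Asymptotic independence: let $(X,Y)$ be a random vector with distribution function $F$ with continuous marginals $F_1,F_2$. Let $P$ be the function on $[0,1]^2$ determined by $P(F_1(x),F_2(y))=\mathbb{P}\{X>x,Y>y\}$; equivalently $P(u,v)=1+C(u,v)-u-v$ where $C$ is the copula of $F$. Then $X$ and $Y$ are asymptotically independent if $P(1-s,1-s)=o(s)$ as $s\downarrow 0$. The components of a random vector in $\mathbb{R}^d$ (with continuous marginals) are asymptotically independent if every two of its components are asymptotically independent. *)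

theory Defs
  imports "HOL-Probability.Probability" "HOL-Library.Landau_Symbols"
begin

definition tangent_plane :: "'a::euclidean_space set \<Rightarrow> 'a \<Rightarrow> 'a set \<Rightarrow> bool" where
  "tangent_plane D p H \<longleftrightarrow>
     (\<exists>a b. a \<noteq> 0 \<and> H = {x. a \<bullet> x = b}) \<and> p \<in> H \<and> H \<inter> D = {}"

definition C1_boundary :: "'a::euclidean_space set \<Rightarrow> bool" where
  "C1_boundary D \<longleftrightarrow> (\<forall>p\<in>frontier D. \<exists>!H. tangent_plane D p H)"

definition marginal_cdf :: "'w measure \<Rightarrow> ('w \<Rightarrow> real) \<Rightarrow> real \<Rightarrow> real" where
  "marginal_cdf M X = cdf (distr M borel X)"

text \<open>
  Only the values of \<open>P\<close> at points \<open>(F\<^sub>1 x, F\<^sub>2 y)\<close> are constrained. For continuous marginals these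
  points cover the open unit square, so \<open>P\<close> is determined there (see
  \<open>tail_function_unique\<close> below), and only such values matter for asymptotic independence.
\<close>

definition tail_function ::
  "'w measure \<Rightarrow> ('w \<Rightarrow> real) \<Rightarrow> ('w \<Rightarrow> real) \<Rightarrow> (real \<Rightarrow> real \<Rightarrow> real) \<Rightarrow> bool" where
  "tail_function M X Y P \<longleftrightarrow>
     (\<forall>x y. P (marginal_cdf M X x) (marginal_cdf M Y y) =
              measure M {\<omega> \<in> space M. X \<omega> > x \<and> Y \<omega> > y})"

definition asymp_indep :: "'w measure \<Rightarrow> ('w \<Rightarrow> real) \<Rightarrow> ('w \<Rightarrow> real) \<Rightarrow> bool" where
  "asymp_indep M X Y \<longleftrightarrow>
     X \<in> borel_measurable M \<and> Y \<in> borel_measurable M \<and>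
     continuous_on UNIV (marginal_cdf M X) \<and> continuous_on UNIV (marginal_cdf M Y) \<and>
     (\<exists>P. tail_function M X Y P \<and> (\<lambda>s. P (1 - s) (1 - s)) \<in> o[at_right 0](\<lambda>s. s))"

definition asymp_indep_components :: "'w measure \<Rightarrow> ('w \<Rightarrow> real ^ 'n) \<Rightarrow> bool" where
  "asymp_indep_components M X \<longleftrightarrow>
     (\<forall>i j. i \<noteq> j \<longrightarrow> asymp_indep M (\<lambda>\<omega>. X \<omega> $ i) (\<lambda>\<omega>. X \<omega> $ j))"

lemma marginal_cdf_surj:
  assumes "prob_space M" "X \<in> borel_measurable M" "continuous_on UNIV (marginal_cdf M X)"
    and u: "0 < u" "u < 1"
  obtains x where "marginal_cdf M X x = u"
proof -
  interpret D: real_distribution "distr M borel X"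
    using assms(1,2) by (simp add: prob_space.real_distribution_distr)
  have "eventually (\<lambda>x. marginal_cdf M X x < u) at_bot"
    unfolding marginal_cdf_def using D.cdf_lim_at_bot u by (auto dest: order_tendstoD)
  then obtain a where a: "\<And>x. x \<le> a \<Longrightarrow> marginal_cdf M X x < u"
    by (auto simp: eventually_at_bot_linorder)
  have "eventually (\<lambda>x. marginal_cdf M X x > u) at_top"
    unfolding marginal_cdf_def using D.cdf_lim_at_top_prob u by (auto dest: order_tendstoD)
  then obtain b where b: "\<And>x. x \<ge> b \<Longrightarrow> marginal_cdf M X x > u"
    by (auto simp: eventually_at_top_linorder)
  have "\<exists>x\<ge>a. x \<le> max a b \<and> marginal_cdf M X x = u"
    using a[of a] b[of "max a b"] assms(3)
    by (intro IVT') (auto intro: continuous_on_subset)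
  then show ?thesis using that by blast
qed

lemma tail_function_unique:
  assumes "prob_space M" "X \<in> borel_measurable M" "Y \<in> borel_measurable M"
    and "continuous_on UNIV (marginal_cdf M X)" "continuous_on UNIV (marginal_cdf M Y)"
    and "tail_function M X Y P" "tail_function M X Y Q"
    and "0 < u" "u < 1" "0 < v" "v < 1"
  shows "P u v = Q u v"
proof -
  obtain x where "marginal_cdf M X x = u" using assms by (metis marginal_cdf_surj)
  moreover obtain y where "marginal_cdf M Y y = v" using assms by (metis marginal_cdf_surj)
  ultimately show ?thesis using assms(6,7) unfolding tail_function_def by metis
qed

end

theory Submission
  imports Defs
begin

text \<open>
  The scales \<open>r n\<close> grow slower and the levels \<open>c n\<close> decay faster than any geometric sequence, so the
  mass outside \<open>r (Suc n) D\<close> is negligible compared with \<open>c n * r n ^ d\<close>. Let two coordinates have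
  tail events of the same small probability, write their thresholds as \<open>t\<close> times the respective
  maximum over \<open>D\<close>, and take the smaller \<open>t\<close>. By the smoothness of the boundary, the joint tail event
  avoids \<open>l t D\<close> for some \<open>l > 1\<close> that depends only on \<open>D\<close>, while the tail event of the coordinate
  with the smaller \<open>t\<close> meets every \<open>\<rho> t D\<close>, \<open>1 < \<rho> < l\<close>, in a set of volume at least a constant
  multiple of \<open>t ^ d\<close>. Several levels lie between the two scales.
\<close>

section \<open>Tangent planes, Lebesgue measure and densities\<close>

lemma tangent_planes_coincide:
  assumes "C1_boundary D" "p \<in> frontier D" "tangent_plane D p H" "tangent_plane D p K"
  shows "H = K"
  using assms unfolding C1_boundary_def by blast

lemma measure_lborel_scaleR_image:
  fixes S :: "'a::euclidean_space set"
  assumes "open S" and "r \<noteq> 0"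
  shows "measure lborel ((\<lambda>x. r *\<^sub>R x) ` S) = \<bar>r\<bar> ^ DIM('a) * measure lborel S"
proof -
  have "open ((\<lambda>x. r *\<^sub>R x) ` S)" using assms by (simp add: open_scaling)
  then show ?thesis
    using measure_lebesgue_affine[of r 0 S] assms by (simp add: measure_completion borel_open)
qed

lemma measure_lborel_pos_open:
  fixes S :: "'a::euclidean_space set"
  assumes "open S" "bounded S" "S \<noteq> {}"
  shows "measure lborel S > 0"
proof (rule ccontr)
  assume "\<not> ?thesis"
  then have "measure lebesgue S = 0"
    using assms by (simp add: measure_completion borel_open not_less measure_le_0_iff)
  then have "negligible S"
    using assms lmeasurable_open by (simp add: negligible_iff_measure)
  then show False using open_not_negligible assms by blast
qed

lemma emeasure_density_le:
  assumes "f \<in> borel_measurable M" "S \<in> sets M" "\<And>x. x \<in> S \<Longrightarrow> f x \<le> C"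
  shows "emeasure (density M f) S \<le> C * emeasure M S"
proof -
  have "emeasure (density M f) S = (\<integral>\<^sup>+x. f x * indicator S x \<partial>M)"
    using assms by (simp add: emeasure_density)
  also have "\<dots> \<le> (\<integral>\<^sup>+x. C * indicator S x \<partial>M)"
    using assms(3) by (intro nn_integral_mono) (auto simp: indicator_def)
  finally show ?thesis using assms by (simp add: nn_integral_cmult_indicator)
qed

lemma emeasure_density_ge:
  assumes "f \<in> borel_measurable M" "S \<in> sets M" "\<And>x. x \<in> S \<Longrightarrow> C \<le> f x"
  shows "C * emeasure M S \<le> emeasure (density M f) S"
proof -
  have "C * emeasure M S = (\<integral>\<^sup>+x. C * indicator S x \<partial>M)"
    using assms by (simp add: nn_integral_cmult_indicator)
  also have "\<dots> \<le> (\<integral>\<^sup>+x. f x * indicator S x \<partial>M)"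
    using assms(3) by (intro nn_integral_mono) (auto simp: indicator_def)
  finally show ?thesis using assms by (simp add: emeasure_density)
qed

section \<open>The support function and simultaneous near-maximizers\<close>

text \<open>The support function of convex geometry; the real-valued \<open>SUP\<close> is a genuine
  supremum only when \<open>D\<close> is bounded and nonempty.\<close>

definition supp_fun :: "'a::euclidean_space set \<Rightarrow> 'a \<Rightarrow> real" where
  "supp_fun D u = (SUP x\<in>D. u \<bullet> x)"

lemma bdd_above_inner:
  fixes D :: "'a::euclidean_space set"
  assumes "bounded D"
  shows "bdd_above ((\<lambda>x. u \<bullet> x) ` D)"
  by (intro bounded_imp_bdd_above bounded_linear_image[OF assms] bounded_linear_inner_right)

lemma inner_le_supp_fun:
  assumes "bounded D" "x \<in> D"
  shows "u \<bullet> x \<le> supp_fun D u"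
  unfolding supp_fun_def using assms bdd_above_inner by (intro cSUP_upper) auto

text \<open>A point of an open set can still be moved a little in direction \<open>u\<close>, so the
  supremum is not attained inside \<open>D\<close>.\<close>

lemma inner_less_supp_fun:
  assumes "bounded D" "open D" "x \<in> D" "u \<noteq> 0"
  shows "u \<bullet> x < supp_fun D u"
proof -
  obtain e where e: "e > 0" "cball x e \<subseteq> D"
    using assms open_contains_cball by blast
  define y where "y = x + (e / norm u) *\<^sub>R u"
  have "y \<in> D" using e assms by (intro subsetD[OF e(2)]) (simp add: y_def dist_norm)
  moreover have "u \<bullet> x < u \<bullet> y"
    using e assms by (simp add: y_def inner_add_right)
  ultimately show ?thesis using inner_le_supp_fun[OF assms(1), of y u] by simp
qed

lemma supp_fun_pos:
  assumes "bounded D" "open D" "0 \<in> D" "u \<noteq> 0"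
  shows "supp_fun D u > 0"
  using inner_less_supp_fun[OF assms] by simp

lemma exists_inner_greater:
  assumes "bounded D" "D \<noteq> {}" "a < supp_fun D u"
  shows "\<exists>x\<in>D. a < u \<bullet> x"
  using assms less_cSUP_iff[OF _ bdd_above_inner] unfolding supp_fun_def by blast

lemma inner_le_supp_fun_closure:
  assumes "bounded D" "x \<in> closure D"
  shows "u \<bullet> x \<le> supp_fun D u"
proof -
  have "closure D \<subseteq> {x. u \<bullet> x \<le> supp_fun D u}"
    using assms inner_le_supp_fun by (intro closure_minimal closed_halfspace_le) auto
  then show ?thesis using assms by auto
qed

text \<open>A point of \<open>closure D\<close> maximizing two orthogonal functionals at once would have two tangent
  planes. By compactness the two functionals are not even nearly maximized simultaneously.\<close>

lemma no_common_near_maximizer: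
  fixes D :: "'a::euclidean_space set"
  assumes D: "bounded D" "open D" "0 \<in> D" "C1_boundary D"
    and uv: "u \<noteq> 0" "v \<noteq> 0" "u \<bullet> v = 0"
  obtains l where "l > 1" "\<And>x. x \<in> D \<Longrightarrow> l * (u \<bullet> x) \<le> supp_fun D u \<or> l * (v \<bullet> x) \<le> supp_fun D v"
proof -
  let ?a = "supp_fun D u" and ?b = "supp_fun D v"
  have pos: "?a > 0" "?b > 0" using D uv supp_fun_pos by auto
  \<comment> \<open>\<open>g\<close> is the smaller of the two functionals, each normalized to have
    supremum 1 over \<open>D\<close>. It reaches 1 only where both are maximal, so a maximum below 1
    yields \<open>l\<close> as a reciprocal.\<close>
  define g where "g x = min ((u \<bullet> x) / ?a) ((v \<bullet> x) / ?b)" for x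
  have "compact (closure D)" using D by (simp add: compact_closure)
  moreover have "closure D \<noteq> {}" using D closure_subset by blast
  moreover have "continuous_on (closure D) g"
    unfolding g_def using pos by (intro continuous_intros) auto
  ultimately obtain p where p: "p \<in> closure D" "\<And>x. x \<in> closure D \<Longrightarrow> g x \<le> g p"
    using continuous_attains_sup by metis
  have "g p < 1"
  proof (rule ccontr)
    assume "\<not> g p < 1"
    then have "(u \<bullet> p) / ?a \<ge> 1" "(v \<bullet> p) / ?b \<ge> 1" by (auto simp: g_def)
    then have "u \<bullet> p \<ge> ?a" "v \<bullet> p \<ge> ?b" using pos by simp_all
    then have eq: "u \<bullet> p = ?a" "v \<bullet> p = ?b"
      using inner_le_supp_fun_closure[OF D(1) p(1)] by (simp_all add: antisym)
    then have "p \<notin> D" using inner_less_supp_fun[OF D(1,2)] uv by (metis less_irrefl)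
    then have "p \<in> frontier D" using p D by (simp add: frontier_def interior_open)
    \<comment> \<open>The hyperplane on which \<open>w\<close> takes its supremum misses the open
      set \<open>D\<close>, because the inequality is strict there.\<close>
    moreover have "tangent_plane D p {x. w \<bullet> x = supp_fun D w}"
      if "w \<noteq> 0" "w \<bullet> p = supp_fun D w" for w
      unfolding tangent_plane_def using that inner_less_supp_fun[OF D(1,2) _ that(1)]
      by (auto dest: less_imp_neq)
    ultimately have same: "{x. u \<bullet> x = ?a} = {x. v \<bullet> x = ?b}"
      using tangent_planes_coincide[OF D(4)] eq uv by blast
    \<comment> \<open>\<open>q\<close> is the point of the plane for \<open>u\<close> on the line
      spanned by \<open>u\<close>. By orthogonality \<open>v\<close> vanishes at \<open>q\<close>,
      so \<open>q\<close> cannot lie on the plane for \<open>v\<close>, whose level is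
      positive.\<close>
    define q where "q = (?a / (u \<bullet> u)) *\<^sub>R u"
    have "u \<bullet> q = ?a" "v \<bullet> q = 0" using uv by (simp_all add: q_def inner_commute)
    then have "v \<bullet> q = ?b" using same by blast
    then show False using \<open>v \<bullet> q = 0\<close> pos by simp
  qed
  \<comment> \<open>The floor 1/2 makes \<open>m\<close> positive, so that \<open>1 / m\<close> is a
    legitimate factor above 1.\<close>
  define m where "m = max (g p) (1/2)"
  have m: "0 < m" "m < 1" "g p \<le> m" using \<open>g p < 1\<close> by (auto simp: m_def)
  show ?thesis
  proof (rule that[of "1 / m"])
    show "1 / m > 1" using m by simp
  next
    fix x assume "x \<in> D"
    then have "x \<in> closure D" using closure_subset by blast
    then have "g x \<le> m" using order_trans[OF p(2) m(3)] by blast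
    then show "1 / m * (u \<bullet> x) \<le> ?a \<or> 1 / m * (v \<bullet> x) \<le> ?b"
      using pos m by (auto simp: g_def min_le_iff_disj field_simps)
  qed
qed

section \<open>Level sets of the density\<close>

text \<open>The tail estimates concern only the law \<open>\<nu>\<close> with density
  \<open>f\<close>; the random vector itself enters outside the locale.\<close>

locale rapid_level_sets =
  fixes D :: "'a::euclidean_space set" and c r :: "nat \<Rightarrow> real" and f :: "'a \<Rightarrow> real"
    and n\<^sub>0 :: nat
  assumes bounded_D: "bounded D" and open_D: "open D" and zero_D: "0 \<in> D"
    and c_pos: "\<And>n. c n > 0" and c_null: "c \<longlonglongrightarrow> 0"
    and c_ratio: "(\<lambda>n. c (Suc n) / c n) \<longlonglongrightarrow> 0"
    and r_pos: "\<And>n. r n > 0" and r_ratio: "(\<lambda>n. r (Suc n) / r n) \<longlonglongrightarrow> 1"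
    and f_cont: "continuous_on UNIV f" and f_nonneg: "\<And>x. f x \<ge> 0"
    and prob: "prob_space (density lborel (\<lambda>x. ennreal (f x)))"
    and levels: "\<And>n. n \<ge> n\<^sub>0 \<Longrightarrow> {x. f x > c n} = (\<lambda>x. r n *\<^sub>R x) ` D"
begin

abbreviation \<nu> :: "'a measure" where
  "\<nu> \<equiv> density lborel (\<lambda>x. ennreal (f x))"

abbreviation L :: "nat \<Rightarrow> 'a set" where
  "L n \<equiv> {x. f x > c n}"

sublocale \<nu>: prob_space \<nu>
  by (rule prob)

lemma f_measurable [measurable]: "f \<in> borel_measurable borel"
  using f_cont by (rule borel_measurable_continuous_onI)

lemma measure_L: "n \<ge> n\<^sub>0 \<Longrightarrow> measure lborel (L n) = r n ^ DIM('a) * measure lborel D"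
  using measure_lborel_scaleR_image[OF open_D, of "r n"] levels r_pos[of n] by simp

lemma open_L: "n \<ge> n\<^sub>0 \<Longrightarrow> open (L n)"
  using levels open_D r_pos[of n] by (simp add: open_scaling)

lemma bounded_L: "n \<ge> n\<^sub>0 \<Longrightarrow> bounded (L n)"
  using levels bounded_D by (simp add: bounded_scaling)

lemma measure_le:
  assumes "S \<in> sets borel" "bounded S" "\<And>x. x \<in> S \<Longrightarrow> f x \<le> C" "C \<ge> 0"
  shows "measure \<nu> S \<le> C * measure lborel S"
proof -
  have fin: "emeasure lborel S < \<infinity>" using assms emeasure_bounded_finite by blast
  have "emeasure \<nu> S \<le> ennreal C * emeasure lborel S"
    using assms by (intro emeasure_density_le) (auto intro: ennreal_leI)
  also have "\<dots> = ennreal (C * measure lborel S)"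
    using assms fin by (simp add: emeasure_eq_ennreal_measure ennreal_mult less_top)
  finally show ?thesis
    using assms by (simp add: \<nu>.emeasure_eq_measure)
qed

lemma measure_ge:
  assumes "S \<in> sets borel" "bounded S" "\<And>x. x \<in> S \<Longrightarrow> C \<le> f x" "C \<ge> 0"
  shows "C * measure lborel S \<le> measure \<nu> S"
proof -
  have fin: "emeasure lborel S < \<infinity>" using assms emeasure_bounded_finite by blast
  have "ennreal C * emeasure lborel S \<le> emeasure \<nu> S"
    using assms by (intro emeasure_density_ge) (auto intro: ennreal_leI)
  moreover have "ennreal C * emeasure lborel S = ennreal (C * measure lborel S)"
    using assms fin by (simp add: emeasure_eq_ennreal_measure ennreal_mult less_top)
  ultimately show ?thesis
    using assms by (simp add: \<nu>.emeasure_eq_measure)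
qed

text \<open>The sets \<open>L n\<close> exhaust only the region where \<open>f\<close> is positive;
  the rest has to be discarded as a null set.\<close>

lemma measure_zero_set: "measure \<nu> {x. f x = 0} = 0"
proof -
  have "emeasure \<nu> {x. f x = 0} \<le> 0 * emeasure lborel {x. f x = 0}"
    by (intro emeasure_density_le) auto
  then show ?thesis by (simp add: measure_def)
qed

lemma eventually_in_L:
  assumes "f x > 0"
  shows "\<exists>n\<ge>N. x \<in> L n"
proof -
  have "eventually (\<lambda>n. c n < f x) sequentially"
    using order_tendstoD(2)[OF c_null assms] .
  then show ?thesis
    by (metis (mono_tags, lifting) eventually_sequentially mem_Collect_eq nle_le)
qed

section \<open>Mass outside a level set\<close>

text \<open>Up to the volume of \<open>D\<close>, a bound for the mass of
  \<open>L (Suc n) - L n\<close>. The indices differ on purpose: outside \<open>L n\<close> the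
  density is at most \<open>c n\<close>, while the volume is governed by the outer scale
  \<open>r (Suc n)\<close>.\<close>

definition shell :: "nat \<Rightarrow> real" where
  "shell n = c n * r (Suc n) ^ DIM('a)"

lemma shell_pos: "shell n > 0"
  using c_pos r_pos by (simp add: shell_def)

text \<open>The quotient of heights tends to 0 and the quotient of scales to 1, so the bounds
  eventually decay faster than any geometric sequence.\<close>

lemma shell_ratio:
  assumes "e > 0"
  shows "\<forall>\<^sub>F n in sequentially. shell (Suc n) \<le> e * shell n"
proof -
  have "(\<lambda>n. c (Suc n) / c n * (r (Suc (Suc n)) / r (Suc n)) ^ DIM('a)) \<longlonglongrightarrow> 0 * 1 ^ DIM('a)"
    by (intro tendsto_intros c_ratio LIMSEQ_Suc[OF r_ratio])
  then have "\<forall>\<^sub>F n in sequentially. c (Suc n) / c n * (r (Suc (Suc n)) / r (Suc n)) ^ DIM('a) < e"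
    using assms by (intro order_tendstoD(2)[where y = "0::real"]) simp_all
  then show ?thesis
  proof eventually_elim
    case (elim n)
    have "shell (Suc n) / shell n = c (Suc n) / c n * (r (Suc (Suc n)) / r (Suc n)) ^ DIM('a)"
      by (simp add: shell_def power_divide)
    then have "shell (Suc n) / shell n < e" using elim by simp
    then show ?case using shell_pos[of n] by (simp add: pos_divide_less_eq less_imp_le)
  qed
qed

lemma measure_shell:
  assumes "n \<ge> n\<^sub>0"
  shows "measure \<nu> (L (Suc n) - L n) \<le> measure lborel D * shell n"
proof -
  have "measure \<nu> (L (Suc n) - L n) \<le> c n * measure lborel (L (Suc n) - L n)"
    using assms c_pos[of n] bounded_L[of "Suc n"]
    by (intro measure_le) (auto intro: bounded_diff)
  also have "\<dots> \<le> c n * measure lborel (L (Suc n))"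
    using assms c_pos[of n] bounded_L[of "Suc n"] open_L[of "Suc n"]
    by (intro mult_left_mono measure_mono_fmeasurable)
      (auto simp: fmeasurable_def emeasure_bounded_finite[unfolded infinity_ennreal_def])
  finally show ?thesis using assms by (simp add: measure_L shell_def mult_ac)
qed

text \<open>Up to the zero set of \<open>f\<close>, the complement of \<open>L m\<close> is covered
  by the shells from \<open>m\<close> on. Their bounds are dominated by a geometric series of ratio
  1/2, whence the factor 2.\<close>

lemma measure_outside_L:
  assumes "N \<ge> n\<^sub>0" and half: "\<And>n. n \<ge> N \<Longrightarrow> shell (Suc n) \<le> 1/2 * shell n" and "m \<ge> N"
  shows "measure \<nu> (- L m) \<le> 2 * measure lborel D * shell m"
proof -
  let ?S = "\<lambda>k. L (Suc (m + k)) - L (m + k)" and ?V = "measure lborel D"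
  have geo: "shell (m + k) \<le> shell m * (1/2) ^ k" for k
  proof (induction k)
    case (Suc k)
    moreover have "shell (m + Suc k) \<le> 1/2 * shell (m + k)" using half[of "m + k"] assms by simp
    ultimately show ?case unfolding power_Suc by linarith
  qed simp
  have bound: "measure \<nu> (?S k) \<le> ?V * shell m * (1/2) ^ k" for k
  proof -
    have "measure \<nu> (?S k) \<le> ?V * shell (m + k)" using assms by (intro measure_shell) simp
    also have "\<dots> \<le> ?V * (shell m * (1/2) ^ k)" by (intro mult_left_mono geo) simp
    finally show ?thesis by (simp add: mult_ac)
  qed
  have sums: "(\<lambda>k. ?V * shell m * (1/2) ^ k) sums (?V * shell m * 2)"
    using sums_mult[OF geometric_sums[of "1/2::real"], of "?V * shell m"] by simp
  have summable: "summable (\<lambda>k. measure \<nu> (?S k))"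
    using bound by (intro summable_comparison_test'[OF sums_summable[OF sums]]) simp
  have S_sets: "range ?S \<subseteq> sets \<nu>" by auto
  have "- L m \<subseteq> {x. f x = 0} \<union> (\<Union>k. ?S k)"
  proof
    fix x assume x: "x \<in> - L m"
    show "x \<in> {x. f x = 0} \<union> (\<Union>k. ?S k)"
    proof (cases "f x = 0")
      case False
      then obtain n where n: "n \<ge> m" "x \<in> L n"
        using f_nonneg[of x] eventually_in_L[of x] by (metis order_le_imp_less_or_eq)
      \<comment> \<open>The least index puts \<open>x\<close> in one level set but not in the
        preceding one, hence in a shell; it is nonzero because \<open>x\<close> lies outside
        \<open>L m\<close>.\<close>
      define j where "j = (LEAST j. x \<in> L (m + j))"
      have ex: "x \<in> L (m + (n - m))" using n by simp
      have j: "x \<in> L (m + j)" unfolding j_def by (rule LeastI[of "\<lambda>j. x \<in> L (m + j)", OF ex])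
      then obtain k where k: "j = Suc k" using x by (cases j) auto
      then have "x \<notin> L (m + k)"
        using not_less_Least[of k "\<lambda>j. x \<in> L (m + j)"] by (auto simp: j_def)
      then have "x \<in> ?S k" using j k by simp
      then show ?thesis by blast
    qed simp
  qed
  then have "measure \<nu> (- L m) \<le> measure \<nu> ({x. f x = 0} \<union> (\<Union>k. ?S k))"
    by (intro \<nu>.finite_measure_mono) auto
  also have "\<dots> \<le> measure \<nu> {x. f x = 0} + measure \<nu> (\<Union>k. ?S k)"
    by (intro measure_Un_le) auto
  also have "\<dots> \<le> (\<Sum>k. measure \<nu> (?S k))"
    using \<nu>.finite_measure_subadditive_countably[OF S_sets summable] measure_zero_set by simp
  also have "\<dots> \<le> (\<Sum>k. ?V * shell m * (1/2) ^ k)"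
    using bound summable sums by (intro suminf_le) (auto simp: sums_iff)
  also have "\<dots> = 2 * ?V * shell m" using sums by (simp add: sums_iff)
  finally show ?thesis .
qed

section \<open>Lower bounds for halfspaces and comparison with far sets\<close>

lemma open_cap: "open {x\<in>D. \<rho> * (u \<bullet> x) > a}"
proof -
  have "open (D \<inter> {x. \<rho> * (u \<bullet> x) > a})"
    using open_D by (intro open_Int open_Collect_less continuous_intros)
  then show ?thesis by (simp add: Int_def)
qed

text \<open>The cap consists of the points of \<open>D\<close> whose \<open>u\<close>-value exceeds
  the fraction \<open>1 / \<rho>\<close> of the supremum. Such points exist by the definition of a
  supremum, and they form an open set.\<close>

lemma measure_cap_pos:
  assumes "u \<noteq> 0" "\<rho> > 1"
  shows "measure lborel {x\<in>D. \<rho> * (u \<bullet> x) > supp_fun D u} > 0"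
proof (rule measure_lborel_pos_open)
  let ?C = "{x\<in>D. \<rho> * (u \<bullet> x) > supp_fun D u}"
  have pos: "supp_fun D u > 0" using supp_fun_pos bounded_D open_D zero_D assms by blast
  have "supp_fun D u / \<rho> < supp_fun D u" using pos assms by (simp add: divide_less_eq)
  then show "?C \<noteq> {}"
    using exists_inner_greater[OF bounded_D, of "supp_fun D u / \<rho>" u] zero_D assms
    by (auto simp: field_simps)
  show "open ?C" by (rule open_cap)
  show "bounded ?C" using bounded_D by (rule bounded_subset) auto
qed

text \<open>The cap scaled by \<open>r m\<close> lies in \<open>L m\<close>, where the density
  exceeds \<open>c m\<close>. It also lies in the halfspace, since \<open>r m / \<rho>\<close> is at
  least \<open>t\<close>.\<close>

lemma measure_halfspace_ge:
  assumes "u \<noteq> 0" "\<rho> > 1" "m \<ge> n\<^sub>0" "r m \<ge> \<rho> * t"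
  shows "c m * (r m ^ DIM('a) * measure lborel {x\<in>D. \<rho> * (u \<bullet> x) > supp_fun D u})
    \<le> measure \<nu> {x. u \<bullet> x > supp_fun D u * t}"
proof -
  let ?C = "{x\<in>D. \<rho> * (u \<bullet> x) > supp_fun D u}" and ?S = "(\<lambda>x. r m *\<^sub>R x)"
  have pos: "supp_fun D u > 0" using supp_fun_pos bounded_D open_D zero_D assms by blast
  have C: "open ?C" by (rule open_cap)
  then have S: "open (?S ` ?C)" using r_pos[of m] by (simp add: open_scaling)
  have sub: "?S ` ?C \<subseteq> L m" using levels[OF assms(3)] by blast
  have half: "?S ` ?C \<subseteq> {x. u \<bullet> x > supp_fun D u * t}"
  proof safe
    fix x assume x: "x \<in> D" "\<rho> * (u \<bullet> x) > supp_fun D u"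
    have "supp_fun D u * (\<rho> * t) \<le> supp_fun D u * r m" using assms pos by simp
    also have "\<dots> < \<rho> * (u \<bullet> x) * r m" using x r_pos[of m] by simp
    finally have "\<rho> * (supp_fun D u * t) < \<rho> * (u \<bullet> ?S x)" by (simp add: mult_ac)
    then show "supp_fun D u * t < u \<bullet> ?S x" using assms by simp
  qed
  have "c m * (r m ^ DIM('a) * measure lborel ?C) = c m * measure lborel (?S ` ?C)"
    using measure_lborel_scaleR_image[OF C, of "r m"] r_pos[of m] by simp
  also have "\<dots> \<le> measure \<nu> (?S ` ?C)"
    using S c_pos[of m] sub assms
    by (intro measure_ge bounded_subset[OF bounded_L]) (auto dest!: subsetD[OF sub])
  also have "\<dots> \<le> measure \<nu> {x. u \<bullet> x > supp_fun D u * t}"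
    by (intro \<nu>.finite_measure_mono half) simp
  finally show ?thesis .
qed

text \<open>The first level \<open>m\<close> whose scale exceeds \<open>\<rho> t\<close> already contributes
  \<open>c m * r m ^ d\<close> to the halfspace, whereas the next level still does not
  meet \<open>E\<close>, so \<open>E\<close> has measure of order \<open>c (Suc m) * r (Suc m) ^ d\<close>. If no such \<open>m\<close>
  exists, the density has bounded support and \<open>E\<close> is a null set.\<close>

lemma far_set_negligible:
  assumes "u \<noteq> 0" "\<rho> > 1" "\<eta> > 0"
  shows "\<forall>\<^sub>F N in sequentially. \<forall>t E. r N \<le> \<rho> * t \<longrightarrow> E \<in> sets borel \<longrightarrow>
    (\<forall>k\<ge>n\<^sub>0. r k \<le> \<rho> ^ 3 * t \<longrightarrow> E \<inter> L k = {}) \<longrightarrow>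
    measure \<nu> E \<le> \<eta> * measure \<nu> {x. u \<bullet> x > supp_fun D u * t}"
proof -
  let ?V = "measure lborel D" and ?C = "{x\<in>D. \<rho> * (u \<bullet> x) > supp_fun D u}"
  let ?v = "measure lborel ?C" and ?d = "DIM('a)"
  have v: "?v > 0" using measure_cap_pos assms by blast
  have V: "?V > 0" using measure_lborel_pos_open open_D bounded_D zero_D by blast
  \<comment> \<open>The bound 1/2 serves the geometric series in \<open>measure_outside_L\<close>;
    the other term is chosen so that the constants collected at the end amount to at most
    \<open>\<eta> * ?v\<close>.\<close>
  define e where "e = min (1/2) (\<eta> * ?v / (2 * ?V * \<rho> ^ ?d))"
  have e: "e > 0" "e \<le> 1/2" and "e \<le> \<eta> * ?v / (2 * ?V * \<rho> ^ ?d)"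
    using v V assms by (auto simp: e_def)
  then have e': "2 * ?V * e * \<rho> ^ ?d \<le> \<eta> * ?v"
    using V assms by (simp add: field_simps)
  obtain N1 where N1: "\<And>n. n \<ge> N1 \<Longrightarrow> shell (Suc n) \<le> e * shell n"
    using shell_ratio[OF e(1)] by (auto simp: eventually_sequentially)
  obtain N2 where N2: "\<And>n. n \<ge> N2 \<Longrightarrow> r (Suc n) / r n < \<rho>"
    using order_tendstoD(2)[OF r_ratio assms(2)] by (auto simp: eventually_sequentially)
  have grow: "r (Suc n) \<le> \<rho> * r n" if "n \<ge> N2" for n
    using N2[OF that] r_pos[of n] by (simp add: pos_divide_less_eq less_imp_le)
  have half: "shell (Suc n) \<le> 1/2 * shell n" if "n \<ge> N1" for n
    using N1[OF that] mult_right_mono[OF e(2), of "shell n"] shell_pos[of n] by linarith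
  show ?thesis
  \<comment> \<open>The starting index depends on \<open>u\<close>, \<open>\<rho>\<close> and
    \<open>\<eta>\<close>, but not on \<open>t\<close> or \<open>E\<close>.\<close>
  proof (rule eventually_sequentiallyI[of "max n\<^sub>0 (max N1 N2)"], intro allI impI)
    fix N t E
    assume N: "N \<ge> max n\<^sub>0 (max N1 N2)" and t: "r N \<le> \<rho> * t" and E: "E \<in> sets borel"
      and disj: "\<forall>k\<ge>n\<^sub>0. r k \<le> \<rho> ^ 3 * t \<longrightarrow> E \<inter> L k = {}"
    have "\<rho> * t > 0" using t r_pos[of N] by linarith
    have r3: "\<rho> * (\<rho> * (\<rho> * t)) = \<rho> ^ 3 * t" by (simp add: power3_eq_cube)
    have mono: "x \<le> \<rho> * x" if "x > 0" for x using that assms by simp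
    have le3: "\<rho> * t \<le> \<rho> ^ 3 * t"
      using mono[of "\<rho> * t"] mono[of "\<rho> * (\<rho> * t)"] \<open>\<rho> * t > 0\<close> assms r3
      by (smt (verit) mult_pos_pos)
    show "measure \<nu> E \<le> \<eta> * measure \<nu> {x. u \<bullet> x > supp_fun D u * t}"
    proof (cases "\<exists>m\<ge>N. r m > \<rho> * t")
      case False
      \<comment> \<open>All scales from \<open>N\<close> on stay below \<open>\<rho> * t\<close>, so
        \<open>E\<close> misses every one of these level sets, and they exhaust the region where
        \<open>f\<close> is positive.\<close>
      have "E \<subseteq> {x. f x = 0}"
      proof
        fix x assume x: "x \<in> E"
        show "x \<in> {x. f x = 0}"
        proof (rule ccontr)
          assume "x \<notin> {x. f x = 0}"
          then have "f x > 0" using f_nonneg[of x] by simp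
          then obtain k where "k \<ge> N" "x \<in> L k" using eventually_in_L by blast
          moreover have "E \<inter> L k = {}"
            using False \<open>k \<ge> N\<close> N le3 by (intro disj[rule_format]) force+
          ultimately show False using x by blast
        qed
      qed
      then have "measure \<nu> E \<le> measure \<nu> {x. f x = 0}" by (intro \<nu>.finite_measure_mono) auto
      then show ?thesis using measure_zero_set assms by (simp add: order_trans[OF _ mult_nonneg_nonneg])
    next
      case True
      define m where "m = (LEAST m. m \<ge> N \<and> r m > \<rho> * t)"
      have m: "m \<ge> N" "r m > \<rho> * t"
        using LeastI_ex[of "\<lambda>m. m \<ge> N \<and> r m > \<rho> * t"] True by (auto simp: m_def)
      \<comment> \<open>Since \<open>r N\<close> does not exceed \<open>\<rho> * t\<close>, the
        first index \<open>m\<close> past that bound has a predecessor \<open>k\<close> at or after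
        \<open>N\<close>, and \<open>r k\<close> is still within the bound.\<close>
      have "m \<noteq> N" using m t by auto
      then obtain k where k: "m = Suc k" "k \<ge> N" using m by (cases m) auto
      then have rk: "r k \<le> \<rho> * t"
        using not_less_Least[of k "\<lambda>m. m \<ge> N \<and> r m > \<rho> * t"] by (force simp: m_def)
      \<comment> \<open>Two growth steps, from \<open>k\<close> to \<open>m\<close> and from
        \<open>m\<close> to \<open>Suc m\<close>, each cost a factor \<open>\<rho>\<close>. Together
        with \<open>r k \<le> \<rho> * t\<close> they account for the cube in the hypothesis on
        \<open>E\<close>.\<close>
      have "r (Suc m) \<le> \<rho> * r m" using m N by (intro grow) simp
      also have "\<dots> \<le> \<rho> * (\<rho> * r k)"
        using grow[of k] k N assms by (intro mult_left_mono) auto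
      also have "\<dots> \<le> \<rho> * (\<rho> * (\<rho> * t))" using rk assms by (intro mult_left_mono) auto
      finally have "E \<inter> L (Suc m) = {}" using disj m N r3 by simp
      then have "measure \<nu> E \<le> measure \<nu> (- L (Suc m))"
        by (intro \<nu>.finite_measure_mono) auto
      also have "\<dots> \<le> 2 * ?V * shell (Suc m)"
        using N m half by (intro measure_outside_L[of N]) auto
      \<comment> \<open>One ratio step supplies the small factor \<open>e\<close>; replacing
        \<open>r (Suc m)\<close> by \<open>\<rho> * r m\<close> produces the quantity
        \<open>c m * r m ^ ?d\<close> of the halfspace bound.\<close>
      also have "\<dots> \<le> 2 * ?V * (e * (c m * (\<rho> * r m) ^ ?d))"
      proof -
        have "shell (Suc m) \<le> e * shell m" using N1 m N by simp
        also have "\<dots> \<le> e * (c m * (\<rho> * r m) ^ ?d)" unfolding shell_def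
          using e c_pos[of m] grow[of m] m N r_pos[of "Suc m"]
          by (intro mult_left_mono power_mono) auto
        finally show ?thesis using V by simp
      qed
      also have "\<dots> = (2 * ?V * e * \<rho> ^ ?d) * (c m * r m ^ ?d)"
        by (simp add: power_mult_distrib mult_ac)
      also have "\<dots> \<le> (\<eta> * ?v) * (c m * r m ^ ?d)"
        using e' c_pos[of m] r_pos[of m] by (intro mult_right_mono) auto
      also have "\<dots> = \<eta> * (c m * (r m ^ ?d * ?v))" by (simp add: mult_ac)
      also have "\<dots> \<le> \<eta> * measure \<nu> {x. u \<bullet> x > supp_fun D u * t}"
        using assms m N by (intro mult_left_mono measure_halfspace_ge) auto
      finally show ?thesis .
    qed
  qed
qed

section \<open>Joint tails of two orthogonal functionals\<close>

text \<open>\<open>far_set_negligible\<close> is applied to the joint tail at the smaller normalized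
  threshold. It compares with the tail of that one functional, and because both tails have
  probability \<open>s\<close>, either case gives the same bound.\<close>

lemma joint_tail_negligible:
  assumes C1: "C1_boundary D" and uv: "u \<noteq> 0" "v \<noteq> 0" "u \<bullet> v = 0" and "\<eta> > 0"
  obtains \<tau> where "\<tau> > 0"
    "\<And>a b s. \<lbrakk>s < \<tau>; measure \<nu> {x. u \<bullet> x > a} = s; measure \<nu> {x. v \<bullet> x > b} = s\<rbrakk>
      \<Longrightarrow> measure \<nu> {x. u \<bullet> x > a \<and> v \<bullet> x > b} \<le> \<eta> * s"
proof -
  let ?h = "supp_fun D"
  obtain l where l: "l > 1" "\<And>x. x \<in> D \<Longrightarrow> l * (u \<bullet> x) \<le> ?h u \<or> l * (v \<bullet> x) \<le> ?h v"
    using no_common_near_maximizer[OF bounded_D open_D zero_D C1 uv] by blast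
  have pos: "?h u > 0" "?h v > 0" using supp_fun_pos bounded_D open_D zero_D uv by blast+
  \<comment> \<open>The cube root, because \<open>far_set_negligible\<close> requires avoidance up
    to scale \<open>\<rho> ^ 3 * t\<close>, which must be \<open>l * t\<close>.\<close>
  define \<rho> where "\<rho> = root 3 l"
  have \<rho>: "\<rho> > 1" "\<rho> ^ 3 = l" using l by (simp_all add: \<rho>_def)
  have "\<forall>\<^sub>F N in sequentially. N \<ge> n\<^sub>0" by (rule eventually_ge_at_top)
  from eventually_happens'[OF sequentially_bot
      eventually_conj[OF this eventually_conj[OF far_set_negligible[OF uv(1) \<rho>(1) \<open>\<eta> > 0\<close>]
        far_set_negligible[OF uv(2) \<rho>(1) \<open>\<eta> > 0\<close>]]]]
  obtain N where N: "N \<ge> n\<^sub>0"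
    and far_u: "\<And>t E. \<lbrakk>r N \<le> \<rho> * t; E \<in> sets borel;
        \<And>k. k \<ge> n\<^sub>0 \<Longrightarrow> r k \<le> \<rho> ^ 3 * t \<Longrightarrow> E \<inter> L k = {}\<rbrakk>
        \<Longrightarrow> measure \<nu> E \<le> \<eta> * measure \<nu> {x. u \<bullet> x > ?h u * t}"
    and far_v: "\<And>t E. \<lbrakk>r N \<le> \<rho> * t; E \<in> sets borel;
        \<And>k. k \<ge> n\<^sub>0 \<Longrightarrow> r k \<le> \<rho> ^ 3 * t \<Longrightarrow> E \<inter> L k = {}\<rbrakk>
        \<Longrightarrow> measure \<nu> E \<le> \<eta> * measure \<nu> {x. v \<bullet> x > ?h v * t}"
    by blast
  \<comment> \<open>\<open>T\<close> is the smallest \<open>t\<close> admissible for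
    \<open>N\<close>. A tail less probable than the one at \<open>T\<close> has its normalized
    threshold beyond \<open>T\<close>, which dictates the choice of \<open>\<tau>\<close>
    below.\<close>
  define T where "T = r N / \<rho>"
  have T: "T > 0" "\<rho> * T = r N" using \<rho> r_pos[of N] by (auto simp: T_def)
  have tail_pos: "measure \<nu> {x. w \<bullet> x > ?h w * T} > 0" if "w \<noteq> 0" for w
    using measure_halfspace_ge[OF that \<rho>(1) N, of T] T measure_cap_pos[OF that \<rho>(1)]
      c_pos[of N] r_pos[of N]
    by (smt (verit) mult_pos_pos zero_less_power)
  define \<tau> where "\<tau> = min (measure \<nu> {x. u \<bullet> x > ?h u * T}) (measure \<nu> {x. v \<bullet> x > ?h v * T})"
  have far: "T \<le> a / ?h w"
    if "w \<noteq> 0" "measure \<nu> {x. w \<bullet> x > a} < measure \<nu> {x. w \<bullet> x > ?h w * T}" for w a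
  proof (rule ccontr)
    have h: "?h w > 0" using supp_fun_pos bounded_D open_D zero_D that by blast
    assume "\<not> ?thesis"
    then have "a \<le> ?h w * T" using h by (simp add: field_simps)
    then have "measure \<nu> {x. w \<bullet> x > ?h w * T} \<le> measure \<nu> {x. w \<bullet> x > a}"
      by (intro \<nu>.finite_measure_mono) auto
    then show False using that by simp
  qed
  show ?thesis
  proof (rule that[of \<tau>])
    show "\<tau> > 0" using tail_pos uv by (simp add: \<tau>_def)
  next
    fix a b s
    assume s: "s < \<tau>" and a: "measure \<nu> {x. u \<bullet> x > a} = s" and b: "measure \<nu> {x. v \<bullet> x > b} = s"
    define t where "t = min (a / ?h u) (b / ?h v)"
    have "T \<le> t" using far[OF uv(1), of a] far[OF uv(2), of b] a b s by (simp add: t_def \<tau>_def)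
    then have t: "r N \<le> \<rho> * t" "t > 0"
      using T \<rho> mult_left_mono[of T t \<rho>] by auto
    let ?E = "{x. u \<bullet> x > a \<and> v \<bullet> x > b}"
    have E: "?E \<in> sets borel" by measurable
    have ab: "?h u * t \<le> a" "?h v * t \<le> b" using pos by (auto simp: t_def min_def field_simps)
    \<comment> \<open>If \<open>r k\<close> times a point \<open>y\<close> of \<open>D\<close> were
      in the joint tail, then \<open>r k \<le> l * t\<close> would push both
      \<open>l * (u \<bullet> y)\<close> and \<open>l * (v \<bullet> y)\<close> above their suprema,
      against the choice of \<open>l\<close>.\<close>
    have disj: "?E \<inter> L k = {}" if k: "k \<ge> n\<^sub>0" "r k \<le> \<rho> ^ 3 * t" for k
    proof (rule ccontr)
      assume "?E \<inter> L k \<noteq> {}"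
      then have "?E \<inter> (\<lambda>x. r k *\<^sub>R x) ` D \<noteq> {}" unfolding levels[OF k(1)] .
      then obtain y where y: "y \<in> D" "u \<bullet> (r k *\<^sub>R y) > a" "v \<bullet> (r k *\<^sub>R y) > b"
        by blast
      have contra: "l * (w \<bullet> y) > ?h w" if "w \<bullet> (r k *\<^sub>R y) > ?h w * t" "?h w > 0" for w
      proof -
        have wy: "w \<bullet> y > 0"
          using that t r_pos[of k] by (smt (verit) inner_scaleR_right mult_pos_pos zero_less_mult_pos)
        have "?h w * t < r k * (w \<bullet> y)" using that by simp
        also have "\<dots> \<le> l * t * (w \<bullet> y)" using k \<rho> wy by (intro mult_right_mono) auto
        finally show ?thesis using t by (simp add: mult_ac)
      qed
      have "l * (u \<bullet> y) > ?h u" "l * (v \<bullet> y) > ?h v"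
        using contra[of u] contra[of v] y(2,3) ab pos by linarith+
      then show False using l(2)[OF y(1)] by linarith
    qed
    show "measure \<nu> ?E \<le> \<eta> * s"
    proof (cases "a / ?h u \<le> b / ?h v")
      case True
      then have "?h u * t = a" using pos by (simp add: t_def)
      then show ?thesis using far_u[OF t(1) E disj] a by simp
    next
      case False
      then have "?h v * t = b" using pos by (simp add: t_def)
      then show ?thesis using far_v[OF t(1) E disj] b by simp
    qed
  qed
qed

end

section \<open>From joint tails to asymptotic independence\<close>

text \<open>Thresholds with the same marginal value define tail events that differ by a null set, so
  the joint tail depends only on the marginal values.\<close>

lemma exists_tail_function:
  assumes "prob_space M" and [measurable]: "X \<in> borel_measurable M" "Y \<in> borel_measurable M"
  obtains P where "tail_function M X Y P"
proof -
  interpret prob_space M by fact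
  have cdf: "marginal_cdf M Z x = prob {\<omega>\<in>space M. Z \<omega> \<le> x}"
    if [measurable]: "Z \<in> borel_measurable M" for Z :: "_ \<Rightarrow> real" and x
    by (simp add: marginal_cdf_def cdf_def2 measure_distr vimage_def Int_def conj_commute)
  have same: "AE \<omega> in M. Z \<omega> > x \<longleftrightarrow> Z \<omega> > x'"
    if [measurable]: "Z \<in> borel_measurable M" and eq: "marginal_cdf M Z x = marginal_cdf M Z x'"
    for Z :: "_ \<Rightarrow> real" and x x'
    using eq
  proof (induction x x' rule: linorder_wlog)
    case (le x x')
    have "prob ({\<omega>\<in>space M. Z \<omega> \<le> x'} - {\<omega>\<in>space M. Z \<omega> \<le> x})
      = prob {\<omega>\<in>space M. Z \<omega> \<le> x'} - prob {\<omega>\<in>space M. Z \<omega> \<le> x}"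
      using le by (intro finite_measure_Diff) auto
    then have "prob ({\<omega>\<in>space M. Z \<omega> \<le> x'} - {\<omega>\<in>space M. Z \<omega> \<le> x}) = 0"
      using le cdf[of Z] by simp
    then have "AE \<omega> in M. \<omega> \<notin> {\<omega>\<in>space M. Z \<omega> \<le> x'} - {\<omega>\<in>space M. Z \<omega> \<le> x}"
      by (subst (asm) prob_eq_0) auto
    then show ?case using AE_space by eventually_elim (use le in auto)
  next
    case (sym x x')
    from sym(1)[OF sym(2)[symmetric]] show ?case by eventually_elim auto
  qed
  let ?Q = "\<lambda>x y. prob {\<omega> \<in> space M. X \<omega> > x \<and> Y \<omega> > y}"
  have well_defined: "?Q x y = ?Q x' y'"
    if "marginal_cdf M X x = marginal_cdf M X x'" "marginal_cdf M Y y = marginal_cdf M Y y'"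
    for x x' y y'
  proof -
    have "AE \<omega> in M. \<omega> \<in> {\<omega> \<in> space M. X \<omega> > x \<and> Y \<omega> > y}
        \<longleftrightarrow> \<omega> \<in> {\<omega> \<in> space M. X \<omega> > x' \<and> Y \<omega> > y'}"
      using same[OF assms(2) that(1)] same[OF assms(3) that(2)] by eventually_elim auto
    then show ?thesis by (intro finite_measure_eq_AE) auto
  qed
  \<comment> \<open>\<open>SOME\<close> picks arbitrary representatives; away from the ranges of the
    marginals the value of \<open>P\<close> is unspecified and also unconstrained.\<close>
  define P where "P p q = ?Q (SOME x. marginal_cdf M X x = p) (SOME y. marginal_cdf M Y y = q)"
    for p q
  have "tail_function M X Y P"
    unfolding tail_function_def P_def
    by (intro allI well_defined) (rule someI, rule refl)+
  then show ?thesis by (rule that)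
qed

text \<open>Reduces the little-o condition to thresholds with equal tail probabilities: continuity
  of the marginals makes \<open>1 - s\<close> a value of both, so \<open>P (1 - s) (1 - s)\<close>
  is a joint tail probability.\<close>

lemma asymp_indepI:
  assumes "prob_space M" and [measurable]: "X \<in> borel_measurable M" "Y \<in> borel_measurable M"
    and cont: "continuous_on UNIV (marginal_cdf M X)" "continuous_on UNIV (marginal_cdf M Y)"
    and small: "\<And>\<eta>. \<eta> > 0 \<Longrightarrow> \<exists>\<tau>>0. \<forall>a b s. s < \<tau> \<longrightarrow>
      measure M {\<omega>\<in>space M. X \<omega> > a} = s \<longrightarrow> measure M {\<omega>\<in>space M. Y \<omega> > b} = s \<longrightarrow>
      measure M {\<omega>\<in>space M. X \<omega> > a \<and> Y \<omega> > b} \<le> \<eta> * s"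
  shows "asymp_indep M X Y"
proof -
  interpret prob_space M by fact
  obtain P where P: "tail_function M X Y P"
    using exists_tail_function[OF assms(1-3)] by blast
  have tail: "prob {\<omega>\<in>space M. Z \<omega> > x} = 1 - marginal_cdf M Z x"
    if [measurable]: "Z \<in> borel_measurable M" for Z :: "_ \<Rightarrow> real" and x
  proof -
    have "marginal_cdf M Z x = prob {\<omega>\<in>space M. Z \<omega> \<le> x}"
      by (simp add: marginal_cdf_def cdf_def2 measure_distr vimage_def Int_def conj_commute)
    moreover have "prob {\<omega>\<in>space M. \<not> Z \<omega> \<le> x} = 1 - prob {\<omega>\<in>space M. Z \<omega> \<le> x}"
      by (intro prob_neg) measurable
    ultimately show ?thesis by (simp add: not_le)
  qed
  have "(\<lambda>s. P (1 - s) (1 - s)) \<in> o[at_right 0](\<lambda>s. s)"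
  proof (rule landau_o.smallI)
    fix \<eta> :: real assume "\<eta> > 0"
    then obtain \<tau> where \<tau>: "\<tau> > 0" "\<And>a b s. \<lbrakk>s < \<tau>; prob {\<omega>\<in>space M. X \<omega> > a} = s;
        prob {\<omega>\<in>space M. Y \<omega> > b} = s\<rbrakk> \<Longrightarrow> prob {\<omega>\<in>space M. X \<omega> > a \<and> Y \<omega> > b} \<le> \<eta> * s"
      using small[OF \<open>\<eta> > 0\<close>] by blast
    \<comment> \<open>The cap at 1 keeps \<open>1 - s\<close> in the open unit interval, as
      \<open>marginal_cdf_surj\<close> demands.\<close>
    have "\<forall>\<^sub>F s in at_right 0. s \<in> {0<..<min \<tau> 1}"
      using \<tau> by (intro eventually_at_right_real) simp
    then show "\<forall>\<^sub>F s in at_right 0. norm (P (1 - s) (1 - s)) \<le> \<eta> * norm s"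
    proof eventually_elim
      case (elim s)
      then have s: "0 < 1 - s" "1 - s < 1" by auto
      obtain a where a: "marginal_cdf M X a = 1 - s"
        using marginal_cdf_surj[OF assms(1,2) cont(1) s] by blast
      obtain b where b: "marginal_cdf M Y b = 1 - s"
        using marginal_cdf_surj[OF assms(1,3) cont(2) s] by blast
      have "P (1 - s) (1 - s) = prob {\<omega>\<in>space M. X \<omega> > a \<and> Y \<omega> > b}"
        using P a b unfolding tail_function_def by metis
      moreover have "\<dots> \<le> \<eta> * s" using elim a b tail[of X a] tail[of Y b] by (intro \<tau>(2)) auto
      ultimately show ?case using elim by simp
    qed
  qed
  then show ?thesis using assms P unfolding asymp_indep_def by blast
qed

text \<open>An atom of the projection would be a hyperplane of positive mass, but hyperplanes are
  Lebesgue null and the law has a density.\<close>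

lemma continuous_marginal_cdf_inner:
  fixes X :: "'w \<Rightarrow> 'a::euclidean_space"
  assumes "prob_space M" and X: "distributed M lborel X g" and "u \<noteq> 0"
  shows "continuous_on UNIV (marginal_cdf M (\<lambda>\<omega>. u \<bullet> X \<omega>))"
proof -
  interpret prob_space M by fact
  have [measurable]: "X \<in> borel_measurable M" using distributed_measurable[OF X] by simp
  interpret R: real_distribution "distr M borel (\<lambda>\<omega>. u \<bullet> X \<omega>)"
    by (intro real_distribution_distr) measurable
  have "isCont (marginal_cdf M (\<lambda>\<omega>. u \<bullet> X \<omega>)) x" for x
  proof -
    let ?H = "{y. u \<bullet> y = x}"
    have "negligible ?H" using negligible_hyperplane \<open>u \<noteq> 0\<close> by blast
    moreover have H: "?H \<in> sets borel" by measurable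
    ultimately have "?H \<in> null_sets lborel"
      by (simp add: negligible_iff_null_sets null_sets_completion_iff)
    moreover have "absolutely_continuous lborel (density lborel g)"
      using distributed_borel_measurable[OF X] by (rule absolutely_continuousI_density)
    ultimately have "?H \<in> null_sets (distr M lborel X)"
      using distributed_distr_eq_density[OF X] by (auto simp: absolutely_continuous_def)
    then have "measure (distr M lborel X) ?H = 0" by (simp add: measure_eq_0_null_sets)
    then have "measure (distr M borel (\<lambda>\<omega>. u \<bullet> X \<omega>)) {x} = 0"
      using H by (simp add: measure_distr vimage_def)
    then show ?thesis by (simp add: marginal_cdf_def R.isCont_cdf)
  qed
  then show ?thesis by (simp add: continuous_on_eq_continuous_at)
qed

theorem theorem1p1:
  fixes D :: "(real ^ 'n) set"
    and c r :: "nat \<Rightarrow> real"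
    and n\<^sub>0 :: nat
    and M :: "'w measure"
    and X :: "'w \<Rightarrow> real ^ 'n"
    and f :: "real ^ 'n \<Rightarrow> real"
  assumes "bounded D" and "open D" and "convex D" and "0 \<in> D" and "C1_boundary D"
    and "\<And>n. c n > 0" and "decseq c" and "c \<longlonglongrightarrow> 0"
    and "(\<lambda>n. c (Suc n) / c n) \<longlonglongrightarrow> 0"
    and "\<And>n. r n > 0" and "(\<lambda>n. r (Suc n) / r n) \<longlonglongrightarrow> 1"
    and "prob_space M"
    and "continuous_on UNIV f" and "\<And>x. f x \<ge> 0"
    and "distributed M lborel X (\<lambda>x. ennreal (f x))"
    and "\<And>n. n \<ge> n\<^sub>0 \<Longrightarrow> {x. f x > c n} = (\<lambda>x. r n *\<^sub>R x) ` D"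
  shows "asymp_indep_components M X"
  unfolding asymp_indep_components_def
proof (intro allI impI)
  fix i j :: 'n assume "i \<noteq> j"
  interpret prob_space M by fact
  have [measurable]: "X \<in> borel_measurable M" using distributed_measurable[OF assms(15)] by simp
  have distr: "distr M lborel X = density lborel (\<lambda>x. ennreal (f x))"
    using distributed_distr_eq_density[OF assms(15)] .
  have prob: "prob_space (density lborel (\<lambda>x. ennreal (f x)))"
    unfolding distr[symmetric] by (intro prob_space_distr) simp
  interpret rapid_level_sets D c r f n\<^sub>0
    by (rule rapid_level_sets.intro) (fact assms prob)+
  \<comment> \<open>Coordinates become inner products with distinct axis vectors, whose
    orthogonality is what \<open>joint_tail_negligible\<close> asks for.\<close>
  define u v :: "real ^ 'n" where "u = axis i 1" and "v = axis j 1"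
  have uv: "u \<noteq> 0" "v \<noteq> 0" "u \<bullet> v = 0"
    using \<open>i \<noteq> j\<close> by (auto simp: u_def v_def axis_eq_0_iff inner_axis_axis)
  have nu: "measure \<nu> S = prob {\<omega>\<in>space M. X \<omega> \<in> S}" if "S \<in> sets borel" for S
    unfolding distr[symmetric] using that
    by (simp add: measure_distr vimage_def Int_def conj_commute)
  have "asymp_indep M (\<lambda>\<omega>. u \<bullet> X \<omega>) (\<lambda>\<omega>. v \<bullet> X \<omega>)"
  proof (rule asymp_indepI)
    fix \<eta> :: real assume "\<eta> > 0"
    from joint_tail_negligible[OF assms(5) uv this] obtain \<tau> where "\<tau> > 0" and
      \<tau>: "\<And>a b s. \<lbrakk>s < \<tau>; measure \<nu> {x. u \<bullet> x > a} = s; measure \<nu> {x. v \<bullet> x > b} = s\<rbrakk>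
        \<Longrightarrow> measure \<nu> {x. u \<bullet> x > a \<and> v \<bullet> x > b} \<le> \<eta> * s"
      by blast
    have "prob {\<omega>\<in>space M. u \<bullet> X \<omega> > a \<and> v \<bullet> X \<omega> > b} \<le> \<eta> * s"
      if "s < \<tau>" "prob {\<omega>\<in>space M. u \<bullet> X \<omega> > a} = s" "prob {\<omega>\<in>space M. v \<bullet> X \<omega> > b} = s" for a b s
      using \<tau>[of s a b] that by (simp add: nu)
    then show "\<exists>\<tau>>0. \<forall>a b s. s < \<tau> \<longrightarrow>
      prob {\<omega>\<in>space M. u \<bullet> X \<omega> > a} = s \<longrightarrow> prob {\<omega>\<in>space M. v \<bullet> X \<omega> > b} = s \<longrightarrow>
      prob {\<omega>\<in>space M. u \<bullet> X \<omega> > a \<and> v \<bullet> X \<omega> > b} \<le> \<eta> * s"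
      using \<open>\<tau> > 0\<close> by blast
  qed (use assms uv continuous_marginal_cdf_inner[OF assms(12,15)] in auto)
  then show "asymp_indep M (\<lambda>\<omega>. X \<omega> $ i) (\<lambda>\<omega>. X \<omega> $ j)"
    by (simp add: u_def v_def inner_axis')
qed

end
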